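(* Let $(i^*,s^* )$ be the provider-optimal policy and let $$\Delta_U:=\max_{i,s}U_i(s,q^*(i,s))-U_{i^*}(s^*,q^*(i^*,s^* )).$$ The following statements are true: 1. If $\xi_1,\xi_2>0$, then $\Delta_U=0$ if and only if $\operatorname{sign}(c_1/p_1-c_2/p_2)=\operatorname{sign}(\xi_2/p_2-\xi_1/p_1)$. 2. If $\xi_1,\xi_2<0$, then $\Delta_U=0$ if and only if $\operatorname{sign}(\xi_2-\xi_1)=\operatorname{sign}\bigl(P-(c_2-c_1)/(p_2-p_1)\bigr)$. 3. If $\operatorname{sign}(\xi_1)\ne\operatorname{sign}(\xi_2)$, then $\Delta_U=0$ if and only if $\xi_{i^*}>0$ and $s^*=0$.
   Context: Two models $M_1,M_2$ have success probabilities $0<p_1<p_2<1$, user latencies $t_1<t_2$ in $[0,1]$, and provider costs $c_1<c_2$ in $[0,1]$. A success is worth $V>0$ to the user, abandonment costs the provider a penalty $P>0$, and $\xi_i:=Vp_i-t_i$ for $i\in\{1,2\}$. A provider policy is a pair $(i,s)$ with $i\in\{1,2\}$ the initial model and $s\in[0,1]$ the probability of cascading from $M_1$ to $M_2$ after a failure of $M_1$ (if $i=2$ the value of $s$ is irrelevant and the policy is written $(2,0)$). The user chooses an abandonment probability $q\in[0,1]$. Let $\alpha(q):=(1-p_1)(1-q)$, $\beta(q):=\frac{1}{p_2+(1-p_2)q}$, and $$S_1(s,q)=\tfrac{p_1+\alpha(q)\beta(q)p_2 s}{1-\alpha(q)(1-s)},\quad L_1(s,q)=\tfrac{t_1+\alpha(q)\beta(q)t_2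 s}{1-\alpha(q)(1-s)},\quad C_1(s,q)=\tfrac{c_1+\alpha(q)\beta(q)c_2 s}{1-\alpha(q)(1-s)},$$ $$S_2(s,q)=\beta(q)p_2,\quad L_2(s,q)=\beta(q)t_2,\quad C_2(s,q)=\beta(q)c_2$$ (success probability, expected latency, expected service cost). User utility: $U_i(s,q):=VS_i(s,q)-L_i(s,q)$. Provider cost: $J_i(s,q):=C_i(s,q)+P(1-S_i(s,q))$. The user best response is $q^*(i,s)\in\arg\max_{q\in[0,1]}U_i(s,q)$, with the conventions $q^*(2,s)=\mathbf 1\{\xi_2<0\}$ and, when $\xi_1<0<\xi_2$, $q^*(1,s)=\mathbf 1\{s<s_0\}$ with $s_0=-\xi_1/(\xi_2/p_2-\xi_1)$. A policy $(i^*,s^* )$ is provider-optimal if it minimizes $J_i(s,q^*(i,s))$ over all $(i,s)\in\{1,2\}\times[0,1]$. The maximum in $\Delta_U$ is over all $(i,s)\in\{1,2\}\times[0,1]$.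
   Formalization: Ties excluded: item 1 assumes c1/p1=c2/p2 exactly when ξ1/p1=ξ2/p2; item 2 assumes P=(c2-c1)/(p2-p1) exactly when ξ1=ξ2; item 3 assumes ξ1>0 or ξ2>0. As printed, each item fails at such ties (e.g. ξ1/p1=ξ2/p2 alone gives Δ_U=0 with unequal signs). *)

theory Defs
  imports Complex_Main
begin

datatype model = M1 | M2

text \<open>
  Parameters: success probabilities \<open>p\<close>, user latencies \<open>t\<close>, provider costs \<open>c\<close>, all indexed by
  the model; the value \<open>V\<close> of a success to the user and the penalty \<open>P\<close> that abandonment costs the
  provider.  A policy \<open>(i, s)\<close> starts with model \<open>i\<close> and cascades from \<open>M1\<close> to \<open>M2\<close> with probability
  \<open>s\<close> after a failure of \<open>M1\<close>; the user abandons with probability \<open>q\<close>.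
\<close>

definition xi :: "real \<Rightarrow> (model \<Rightarrow> real) \<Rightarrow> (model \<Rightarrow> real) \<Rightarrow> model \<Rightarrow> real" where
  "xi V p t i = V * p i - t i"

definition alpha :: "(model \<Rightarrow> real) \<Rightarrow> real \<Rightarrow> real" where
  "alpha p q = (1 - p M1) * (1 - q)"

definition beta :: "(model \<Rightarrow> real) \<Rightarrow> real \<Rightarrow> real" where
  "beta p q = 1 / (p M2 + (1 - p M2) * q)"

fun success :: "(model \<Rightarrow> real) \<Rightarrow> model \<Rightarrow> real \<Rightarrow> real \<Rightarrow> real" where
  "success p M1 s q = (p M1 + alpha p q * beta p q * p M2 * s) / (1 - alpha p q * (1 - s))"
| "success p M2 s q = beta p q * p M2"

fun latency :: "(model \<Rightarrow> real) \<Rightarrow> (model \<Rightarrow> real) \<Rightarrow> model \<Rightarrow> real \<Rightarrow> real \<Rightarrow> real" where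
  "latency p t M1 s q = (t M1 + alpha p q * beta p q * t M2 * s) / (1 - alpha p q * (1 - s))"
| "latency p t M2 s q = beta p q * t M2"

fun service_cost :: "(model \<Rightarrow> real) \<Rightarrow> (model \<Rightarrow> real) \<Rightarrow> model \<Rightarrow> real \<Rightarrow> real \<Rightarrow> real" where
  "service_cost p c M1 s q = (c M1 + alpha p q * beta p q * c M2 * s) / (1 - alpha p q * (1 - s))"
| "service_cost p c M2 s q = beta p q * c M2"

definition user_utility ::
  "real \<Rightarrow> (model \<Rightarrow> real) \<Rightarrow> (model \<Rightarrow> real) \<Rightarrow> model \<Rightarrow> real \<Rightarrow> real \<Rightarrow> real" where
  "user_utility V p t i s q = V * success p i s q - latency p t i s q"

definition provider_cost ::
  "real \<Rightarrow> (model \<Rightarrow> real) \<Rightarrow> (model \<Rightarrow> real) \<Rightarrow> model \<Rightarrow> real \<Rightarrow> real \<Rightarrow> real" where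
  "provider_cost P p c i s q = service_cost p c i s q + P * (1 - success p i s q)"

text \<open>
  \<open>qs\<close> selects a user best response to every policy.  The last two conjuncts fix the selection
  where several abandonment probabilities may be optimal.  No tie-breaking rule is imposed in the
  remaining cases of indifference, which can occur for \<open>M1\<close> only if some \<open>xi V p t i\<close> is \<open>0\<close>.
\<close>

definition best_response ::
  "real \<Rightarrow> (model \<Rightarrow> real) \<Rightarrow> (model \<Rightarrow> real) \<Rightarrow> (model \<Rightarrow> real \<Rightarrow> real) \<Rightarrow> bool" where
  "best_response V p t qs \<longleftrightarrow>
     (\<forall>i. \<forall>s\<in>{0..1}. is_arg_max (user_utility V p t i s) (\<lambda>q. q \<in> {0..1}) (qs i s)) \<and>
     (\<forall>s\<in>{0..1}. qs M2 s = (if xi V p t M2 < 0 then 1 else 0)) \<and>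
     (xi V p t M1 < 0 \<and> 0 < xi V p t M2 \<longrightarrow>
        (\<forall>s\<in>{0..1}. qs M1 s =
           (if s < - xi V p t M1 / (xi V p t M2 / p M2 - xi V p t M1) then 1 else 0)))"

text \<open>
  Policies starting with \<open>M2\<close> do not depend on \<open>s\<close> and are represented by \<open>(M2, 0)\<close>; the second
  conjunct only fixes this representative.
\<close>

definition provider_optimal ::
  "real \<Rightarrow> (model \<Rightarrow> real) \<Rightarrow> (model \<Rightarrow> real) \<Rightarrow> (model \<Rightarrow> real \<Rightarrow> real) \<Rightarrow> model \<times> real \<Rightarrow> bool" where
  "provider_optimal P p c qs \<pi> \<longleftrightarrow>
     is_arg_min (\<lambda>(i, s). provider_cost P p c i s (qs i s)) (\<lambda>(i, s). s \<in> {0..1}) \<pi> \<and>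
     (fst \<pi> = M2 \<longrightarrow> snd \<pi> = 0)"

text \<open>\<open>GREATEST\<close> rather than \<open>SUP\<close>: the best achievable utility is an attained maximum.\<close>

definition utility_gap ::
  "real \<Rightarrow> (model \<Rightarrow> real) \<Rightarrow> (model \<Rightarrow> real) \<Rightarrow> (model \<Rightarrow> real \<Rightarrow> real) \<Rightarrow> model \<times> real \<Rightarrow> real" where
  "utility_gap V p t qs \<pi> =
     (GREATEST u. \<exists>i. \<exists>s\<in>{0..1}. u = user_utility V p t i s (qs i s)) -
     user_utility V p t (fst \<pi>) (snd \<pi>) (qs (fst \<pi>) (snd \<pi>))"

end

theory Submission
  imports Defs
begin

text \<open>
  If both \<open>\<xi>\<^sub>i\<close> have the same strict sign, the user's best response is constant in the policy.
  For positive signs it is \<open>q = 0\<close>: every task then succeeds, and the utility and the provider cost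
  of \<open>(M1, s)\<close> interpolate, with the same weight, between \<open>\<xi>\<^sub>1/p\<^sub>1\<close>, \<open>\<xi>\<^sub>2/p\<^sub>2\<close> and between
  \<open>c\<^sub>1/p\<^sub>1\<close>, \<open>c\<^sub>2/p\<^sub>2\<close>.  For negative signs it is \<open>q = 1\<close>, and only the initial model matters.
  In the mixed case the best utility is attained only by the model with \<open>\<xi>\<^sub>i > 0\<close> used
  without cascading, whatever the remaining best responses are.  The provider cost needs no
  separate analysis: it is \<open>P\<close> minus the utility of a user with value \<open>P\<close> and latencies \<open>c\<close>.
\<close>

section \<open>Closed forms of the gap, the utility and the cost\<close>

text \<open>An attained upper bound determines \<open>GREATEST\<close>, so each case exhibits a
  maximizing policy.\<close>

lemma utility_gap_eq:
  assumes "s \<in> {0..1}" and "u = user_utility V p t i s (qs i s)"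
    and "\<And>j r. r \<in> {0..1} \<Longrightarrow> user_utility V p t j r (qs j r) \<le> u"
  shows "utility_gap V p t qs \<pi> = u - user_utility V p t (fst \<pi>) (snd \<pi>) (qs (fst \<pi>) (snd \<pi>))"
proof -
  have "(GREATEST u. \<exists>i. \<exists>s\<in>{0..1}. u = user_utility V p t i s (qs i s)) = u"
    using assms by (intro Greatest_equality) blast+
  then show ?thesis
    by (simp add: utility_gap_def)
qed

text \<open>Success and latency share a denominator and combine into \<open>xi\<close>. The factor
  \<open>beta p q * xi V p t M2\<close> is the value of continuing with \<open>M2\<close> after a
  cascade.\<close>

lemma user_utility_M1:
  "user_utility V p t M1 s q =
     (xi V p t M1 + alpha p q * s * (beta p q * xi V p t M2)) / (1 - alpha p q * (1 - s))"
  by (simp add: user_utility_def xi_def diff_divide_distrib[symmetric]) (simp add: algebra_simps)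

lemma user_utility_M2: "user_utility V p t M2 s q = beta p q * xi V p t M2"
  by (simp add: user_utility_def xi_def algebra_simps)

lemma provider_cost_eq: "provider_cost P p c i s q = P - user_utility P p c i s q"
  by (cases i) (simp_all add: provider_cost_def user_utility_def algebra_simps)

lemma alpha_simps [simp]: "alpha p 0 = 1 - p M1" "alpha p 1 = 0"
  and beta_simps [simp]: "beta p 0 = 1 / p M2" "beta p 1 = 1"
  by (simp_all add: alpha_def beta_def)

lemma user_utility_abandon: "user_utility V p t i s 1 = xi V p t i"
  by (cases i) (simp_all add: user_utility_M1 user_utility_M2)

section \<open>Bounds on the coefficients\<close>

locale two_models =
  fixes p :: "model \<Rightarrow> real"
  assumes p_M1_pos: "0 < p M1" and p_less: "p M1 < p M2" and p_M2_less_1: "p M2 < 1"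
begin

lemma alpha_bounds:
  assumes "q \<in> {0..1}"
  shows "0 \<le> alpha p q" "alpha p q \<le> 1 - p M1"
  using assms p_less p_M2_less_1 by (auto simp: alpha_def mult_left_le)

lemma beta_bounds:
  assumes "q \<in> {0..1}"
  shows "0 < beta p q" "beta p q \<le> 1 / p M2"
proof -
  have "p M2 \<le> p M2 + (1 - p M2) * q"
    using assms p_M2_less_1 by simp
  then show "0 < beta p q" "beta p q \<le> 1 / p M2"
    unfolding beta_def using p_M1_pos p_less by (simp_all add: frac_le)
qed

text \<open>All three rest on \<open>alpha p q \<le> 1 - p M1\<close>: the denominator is least at
  \<open>q = 0\<close>, and it exceeds \<open>alpha p q * s\<close> by
  \<open>1 - alpha p q\<close>.\<close>

lemma denominator_bounds:
  assumes "q \<in> {0..1}" "s \<in> {0..1}"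
  shows "p M1 + (1 - p M1) * s \<le> 1 - alpha p q * (1 - s)" "alpha p q * s < 1 - alpha p q * (1 - s)"
    "0 < 1 - alpha p q * (1 - s)"
proof -
  have "alpha p q * (1 - s) \<le> (1 - p M1) * (1 - s)"
    using assms alpha_bounds[of q] by (intro mult_right_mono) auto
  then show *: "p M1 + (1 - p M1) * s \<le> 1 - alpha p q * (1 - s)"
    by (simp add: algebra_simps)
  show "alpha p q * s < 1 - alpha p q * (1 - s)"
    using assms alpha_bounds(2)[of q] p_M1_pos by (simp add: algebra_simps)
  have "0 \<le> (1 - p M1) * s"
    using assms p_less p_M2_less_1 by simp
  then show "0 < 1 - alpha p q * (1 - s)"
    using * p_M1_pos by linarith
qed

section \<open>Interpolation for persistent users\<close>

text \<open>The probability that a user who never abandons is cascaded to \<open>M2\<close> before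
  \<open>M1\<close> succeeds.\<close>

definition weight :: "real \<Rightarrow> real" where
  "weight s = (1 - p M1) * s / (p M1 + (1 - p M1) * s)"

lemma weight_bounds:
  assumes "s \<in> {0..1}"
  shows "0 \<le> weight s" "weight s < 1" "weight s = 0 \<longleftrightarrow> s = 0"
proof -
  have "0 \<le> (1 - p M1) * s"
    using assms p_less p_M2_less_1 by simp
  then show "0 \<le> weight s" "weight s < 1"
    using p_M1_pos by (simp_all add: weight_def)
  show "weight s = 0 \<longleftrightarrow> s = 0"
    using \<open>0 \<le> (1 - p M1) * s\<close> p_M1_pos p_less p_M2_less_1 by (simp add: weight_def)
qed

lemma user_utility_M1_persist:
  assumes "s \<in> {0..1}"
  shows "user_utility V p t M1 s 0 =
    xi V p t M1 / p M1 + weight s * (xi V p t M2 / p M2 - xi V p t M1 / p M1)"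
proof -
  have "0 \<le> (1 - p M1) * s"
    using assms p_less p_M2_less_1 by simp
  then have d: "p M1 + (1 - p M1) * s \<noteq> 0"
    using p_M1_pos by linarith
  have "user_utility V p t M1 s 0 =
      (xi V p t M1 / p M1 * p M1 + (1 - p M1) * s * (xi V p t M2 / p M2)) / (p M1 + (1 - p M1) * s)"
    using p_M1_pos by (simp add: user_utility_M1) (simp add: algebra_simps)
  also have "\<dots> = xi V p t M1 / p M1 + weight s * (xi V p t M2 / p M2 - xi V p t M1 / p M1)"
  proof -
    \<comment> \<open>Here \<open>x = p M1\<close> and \<open>y = (1 - p M1) * s\<close>: a weighted
      mean, read as interpolation from \<open>A\<close> to \<open>B\<close>.\<close>
    have "(A * x + y * B) / (x + y) = A + y / (x + y) * (B - A)" if "x + y \<noteq> 0" for A B x y :: real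
      using that by (simp add: field_simps)
    then show ?thesis
      using d unfolding weight_def by blast
  qed
  finally show ?thesis .
qed

lemma provider_cost_persist:
  assumes "s \<in> {0..1}"
  shows "provider_cost P p c M1 s 0 = c M1 / p M1 + weight s * (c M2 / p M2 - c M1 / p M1)"
    and "provider_cost P p c M2 s 0 = c M2 / p M2"
proof -
  have "xi P p c i / p i = P - c i / p i" for i
    using p_M1_pos p_less by (cases i) (simp_all add: xi_def diff_divide_distrib)
  then show "provider_cost P p c M1 s 0 = c M1 / p M1 + weight s * (c M2 / p M2 - c M1 / p M1)"
    and "provider_cost P p c M2 s 0 = c M2 / p M2"
    using user_utility_M1_persist[OF assms, of P c]
    by (simp_all add: provider_cost_eq user_utility_M2 right_diff_distrib)
qed

section \<open>Extremal abandonment probabilities for equal signs\<close>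

lemma user_utility_less_persist:
  assumes "0 < xi V p t M1" "0 < xi V p t M2" "s \<in> {0..1}" "0 < q" "q \<le> 1"
  shows "user_utility V p t M1 s q < user_utility V p t M1 s 0"
proof -
  define a a0 k k0 where "a = alpha p q" and "a0 = 1 - p M1"
    and "k = beta p q * xi V p t M2" and "k0 = xi V p t M2 / p M2"
  have a: "0 \<le> a" "a < a0" "a0 < 1"
    using alpha_bounds[of q] assms p_M1_pos p_less p_M2_less_1
    by (auto simp: a_def a0_def alpha_def)
  have k: "0 < k" "k \<le> k0"
    using mult_right_mono[OF beta_bounds(2)[of q], of "xi V p t M2"] beta_bounds(1)[of q] assms
    by (simp_all add: k_def k0_def)
  have d: "0 < 1 - a * (1 - s)" "0 < 1 - a0 * (1 - s)"
    using denominator_bounds(3)[of q s] denominator_bounds(3)[of 0 s] assms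
    by (simp_all add: a_def a0_def)
  have "(xi V p t M1 + a * s * k) / (1 - a * (1 - s))
      < (xi V p t M1 + a0 * s * k0) / (1 - a0 * (1 - s))"
  \<comment> \<open>Passing from \<open>q\<close> to \<open>0\<close> raises the numerator strictly
    only if \<open>s > 0\<close> and lowers the denominator strictly only if
    \<open>s < 1\<close>.\<close>
  proof (cases "s = 0")
    case True
    then show ?thesis
      using a assms by (simp add: frac_less2)
  next
    case False
    have "a * s * k \<le> a * s * k0"
      using a k assms by (intro mult_left_mono) auto
    also have "\<dots> < a0 * s * k0"
      using a k assms False by (intro mult_strict_right_mono) auto
    finally have "xi V p t M1 + a * s * k < xi V p t M1 + a0 * s * k0"
      by simp
    moreover have "1 - a0 * (1 - s) \<le> 1 - a * (1 - s)"
      using a assms by (simp add: mult_right_mono)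
    moreover have "0 \<le> xi V p t M1 + a * s * k"
      using a k assms by simp
    ultimately show ?thesis
      using d by (intro frac_less) auto
  qed
  then show ?thesis
    by (simp add: user_utility_M1 a_def a0_def k_def k0_def)
qed

lemma user_utility_less_abandon:
  assumes "xi V p t M1 < 0" "xi V p t M2 < 0" "s \<in> {0..1}" "0 \<le> q" "q < 1"
  shows "user_utility V p t M1 s q < user_utility V p t M1 s 1"
proof -
  define a k d where "a = alpha p q" and "k = beta p q * xi V p t M2" and "d = 1 - a * (1 - s)"
  have "0 < a"
    using assms p_less p_M2_less_1 by (simp add: a_def alpha_def)
  have "k < 0"
    using beta_bounds(1)[of q] assms by (simp add: k_def mult_pos_neg)
  have d: "0 < d"
    using denominator_bounds(3)[of q s] assms by (simp add: a_def d_def)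
  \<comment> \<open>Cascading adds \<open>a * s * k\<close>, retrying adds
    \<open>- xi V p t M1 * (a * (1 - s))\<close> on the right; the former is strict at
    \<open>s = 1\<close>, the latter for \<open>s < 1\<close>.\<close>
  have "xi V p t M1 + a * s * k < xi V p t M1 * d"
  proof (cases "s = 1")
    case True
    then show ?thesis
      using \<open>0 < a\<close> \<open>k < 0\<close> by (simp add: d_def mult_pos_neg)
  next
    case False
    have "a * s * k \<le> 0"
      using \<open>0 < a\<close> \<open>k < 0\<close> assms by (intro mult_nonneg_nonpos) auto
    moreover have "xi V p t M1 * (a * (1 - s)) < 0"
      using \<open>0 < a\<close> assms False by (intro mult_neg_pos) auto
    ultimately show ?thesis
      unfolding d_def by (simp only: right_diff_distrib mult_1_right)
  qed
  then have "(xi V p t M1 + a * s * k) / d < xi V p t M1"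
    using d by (simp add: pos_divide_less_eq)
  then show ?thesis
    by (simp add: user_utility_M1 a_def k_def d_def)
qed

section \<open>Strict bounds for mixed signs, valid for every \<open>q\<close>\<close>

text \<open>Cascading adds nothing positive to the numerator, and \<open>s > 0\<close> pushes the
  denominator above \<open>p M1\<close>.\<close>

lemma user_utility_M1_cascade_less:
  assumes "0 < xi V p t M1" "xi V p t M2 \<le> 0" "q \<in> {0..1}" "0 < s" "s \<le> 1"
  shows "user_utility V p t M1 s q < xi V p t M1 / p M1"
proof -
  have d: "p M1 < 1 - alpha p q * (1 - s)"
  proof -
    have "0 < (1 - p M1) * s"
      using assms p_less p_M2_less_1 by simp
    then show ?thesis
      using denominator_bounds(1)[of q s] assms by simp
  qed
  have "alpha p q * s * (beta p q * xi V p t M2) \<le> 0"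
    using alpha_bounds(1)[of q] beta_bounds(1)[of q] assms
    by (intro mult_nonneg_nonpos) (auto simp: mult_nonneg_nonpos)
  then have "user_utility V p t M1 s q \<le> xi V p t M1 / (1 - alpha p q * (1 - s))"
    unfolding user_utility_M1 using d p_M1_pos by (intro divide_right_mono) auto
  also have "\<dots> < xi V p t M1 / p M1"
    using d p_M1_pos assms by (intro divide_strict_left_mono) auto
  finally show ?thesis .
qed

text \<open>Only the cascade can contribute positively, and its coefficient
  \<open>alpha p q * s\<close> is strictly below the denominator.\<close>

lemma user_utility_M1_less_M2:
  assumes "xi V p t M1 \<le> 0" "0 < xi V p t M2" "q \<in> {0..1}" "s \<in> {0..1}"
  shows "user_utility V p t M1 s q < xi V p t M2 / p M2"
proof -
  have k: "beta p q * xi V p t M2 \<le> xi V p t M2 / p M2"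
    using mult_right_mono[OF beta_bounds(2)[of q], of "xi V p t M2"] assms by simp
  have "xi V p t M1 + alpha p q * s * (beta p q * xi V p t M2)
      \<le> alpha p q * s * (xi V p t M2 / p M2)"
    using mult_left_mono[OF k, of "alpha p q * s"] alpha_bounds(1)[of q] assms by auto
  also have "\<dots> < (1 - alpha p q * (1 - s)) * (xi V p t M2 / p M2)"
    using denominator_bounds(2)[of q s] assms p_M1_pos p_less
    by (intro mult_strict_right_mono) auto
  finally show ?thesis
    using denominator_bounds(3)[of q s] assms
    by (simp add: user_utility_M1 pos_divide_less_eq mult.commute)
qed

section \<open>User best responses\<close>

context
  fixes t :: "model \<Rightarrow> real" and V :: real and qs :: "model \<Rightarrow> real \<Rightarrow> real"
  assumes best: "best_response V p t qs"
begin

lemma best_response_range: "s \<in> {0..1} \<Longrightarrow> qs i s \<in> {0..1}"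
  using best unfolding best_response_def is_arg_max_def by blast

lemma best_response_optimal:
  "s \<in> {0..1} \<Longrightarrow> q \<in> {0..1} \<Longrightarrow> user_utility V p t i s q \<le> user_utility V p t i s (qs i s)"
  using best unfolding best_response_def is_arg_max_linorder by blast

lemma best_response_M2: "s \<in> {0..1} \<Longrightarrow> qs M2 s = (if xi V p t M2 < 0 then 1 else 0)"
  using best unfolding best_response_def by blast

lemma best_response_persist:
  assumes "0 < xi V p t M1" "0 < xi V p t M2" "s \<in> {0..1}"
  shows "qs i s = 0"
proof (cases i)
  case M1
  then show ?thesis
    using user_utility_less_persist[OF assms, of "qs M1 s"] best_response_range[of s M1]
      best_response_optimal[of s 0 M1] assms
    by fastforce
next
  case M2
  then show ?thesis
    using best_response_M2[of s] assms by simp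
qed

lemma best_response_abandon:
  assumes "xi V p t M1 < 0" "xi V p t M2 < 0" "s \<in> {0..1}"
  shows "qs i s = 1"
proof (cases i)
  case M1
  then show ?thesis
    using user_utility_less_abandon[OF assms, of "qs M1 s"] best_response_range[of s M1]
      best_response_optimal[of s 1 M1] assms
    by fastforce
next
  case M2
  then show ?thesis
    using best_response_M2[of s] assms by simp
qed

section \<open>The gap for equal signs\<close>

lemma utility_gap_persist:
  assumes "0 < xi V p t M1" "0 < xi V p t M2"
    and ties: "c M1 / p M1 = c M2 / p M2 \<longleftrightarrow> xi V p t M2 / p M2 = xi V p t M1 / p M1"
    and opt: "provider_optimal P p c qs (i_opt, s_opt)"
  shows "utility_gap V p t qs (i_opt, s_opt) = 0 \<longleftrightarrow>
    sgn (c M1 / p M1 - c M2 / p M2) = sgn (xi V p t M2 / p M2 - xi V p t M1 / p M1)"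
proof -
  define r k where "r i = xi V p t i / p i" and "k i = c i / p i" for i
  have q: "qs i s = 0" if "s \<in> {0..1}" for i s
    using best_response_persist assms that by blast
  have u1: "user_utility V p t M1 s (qs M1 s) = r M1 + weight s * (r M2 - r M1)"
    and u2: "user_utility V p t M2 s (qs M2 s) = r M2" if "s \<in> {0..1}" for s
    using that by (simp_all add: q user_utility_M1_persist user_utility_M2 r_def)
  have j1: "provider_cost P p c M1 s (qs M1 s) = k M1 + weight s * (k M2 - k M1)"
    and j2: "provider_cost P p c M2 s (qs M2 s) = k M2" if "s \<in> {0..1}" for s
    using that by (simp_all add: q provider_cost_persist k_def)
  have w0: "weight 0 = 0"
    by (simp add: weight_def)
  have s: "s_opt \<in> {0..1}"
    and min: "\<And>i s. s \<in> {0..1} \<Longrightarrow>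
      provider_cost P p c i_opt s_opt (qs i_opt s_opt) \<le> provider_cost P p c i s (qs i s)"
    using opt unfolding provider_optimal_def is_arg_min_linorder by auto
  have le: "user_utility V p t i s (qs i s) \<le> max (r M1) (r M2)" if "s \<in> {0..1}" for i s
  proof (cases i)
    case M1
    have "(1 - weight s) * r M1 + weight s * r M2 \<le> max (r M1) (r M2)"
      using weight_bounds(1,2)[OF that] by (intro convex_bound_le) auto
    then show ?thesis
      using M1 that by (simp add: u1 algebra_simps)
  qed (use that in \<open>simp add: u2\<close>)
  have "\<exists>i. max (r M1) (r M2) = user_utility V p t i 0 (qs i 0)"
  proof (cases "r M1 \<le> r M2")
    case True
    then have "max (r M1) (r M2) = user_utility V p t M2 0 (qs M2 0)"
      by (simp add: u2)
    then show ?thesis ..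
  next
    case False
    then have "max (r M1) (r M2) = user_utility V p t M1 0 (qs M1 0)"
      by (simp add: u1 w0)
    then show ?thesis ..
  qed
  then obtain i where "max (r M1) (r M2) = user_utility V p t i 0 (qs i 0)" ..
  then have gap: "utility_gap V p t qs (i_opt, s_opt) =
      max (r M1) (r M2) - user_utility V p t i_opt s_opt (qs i_opt s_opt)"
    using utility_gap_eq[of 0 _ V p t i qs] le by auto
  consider "k M1 < k M2" | "k M2 < k M1" | "k M1 = k M2"
    by linarith
  then have "utility_gap V p t qs (i_opt, s_opt) = 0 \<longleftrightarrow>
    sgn (k M1 - k M2) = sgn (r M2 - r M1)"
  proof cases
    case 1
    have "i_opt = M1"
      using min[of 0 M1] s 1 by (cases i_opt) (simp_all add: j1 j2 w0)
    moreover have "weight s_opt * (k M2 - k M1) \<le> 0"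
      using min[of 0 M1] s \<open>i_opt = M1\<close> by (simp add: j1 w0)
    \<comment> \<open>The utility depends on \<open>s_opt\<close> only through its weight, so this
      already identifies it with that of \<open>(M1, 0)\<close>.\<close>
    then have "weight s_opt = 0"
      using 1 weight_bounds(1)[OF s] by (auto simp: mult_le_0_iff)
    ultimately show ?thesis
      using 1 ties s unfolding gap by (auto simp: u1 sgn_real_def r_def k_def max_def)
  next
    case 2
    have "i_opt = M2"
    proof (rule ccontr)
      assume "i_opt \<noteq> M2"
      then have "i_opt = M1"
        by (cases i_opt) auto
      \<comment> \<open>The left side is the extra cost of \<open>(M1, s_opt)\<close> over
        \<open>M2\<close>; as the weight stays below 1, no cascade probability makes up for starting
        with \<open>M1\<close>.\<close>
      then have "(1 - weight s_opt) * (k M1 - k M2) \<le> 0"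
        using min[of 0 M2] s by (simp add: j1 j2 algebra_simps)
      then show False
        using 2 weight_bounds(2)[OF s] by (auto simp: mult_le_0_iff)
    qed
    then show ?thesis
      using 2 ties s unfolding gap by (auto simp: u2 sgn_real_def r_def k_def max_def)
  next
    case 3
    \<comment> \<open>All policies are now worth the same to the user, so the provider's choice
      among its optima is irrelevant.\<close>
    then have "r M1 = r M2"
      using ties by (simp add: r_def k_def)
    then show ?thesis
      using 3 s unfolding gap by (cases i_opt) (simp_all add: u1 u2)
  qed
  then show ?thesis
    by (simp add: r_def k_def)
qed

lemma utility_gap_abandon:
  assumes "xi V p t M1 < 0" "xi V p t M2 < 0"
    and ties: "P = (c M2 - c M1) / (p M2 - p M1) \<longleftrightarrow> xi V p t M2 = xi V p t M1"
    and opt: "provider_optimal P p c qs (i_opt, s_opt)"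
  shows "utility_gap V p t qs (i_opt, s_opt) = 0 \<longleftrightarrow>
    sgn (xi V p t M2 - xi V p t M1) = sgn (P - (c M2 - c M1) / (p M2 - p M1))"
proof -
  define x where "x i = xi V p t i" for i
  have q: "qs i s = 1" if "s \<in> {0..1}" for i s
    using best_response_abandon assms that by blast
  have u: "user_utility V p t i s (qs i s) = x i" if "s \<in> {0..1}" for i s
    using that by (simp add: q user_utility_abandon x_def)
  have s: "s_opt \<in> {0..1}"
    and min: "\<And>i s. s \<in> {0..1} \<Longrightarrow>
      provider_cost P p c i_opt s_opt (qs i_opt s_opt) \<le> provider_cost P p c i s (qs i s)"
    using opt unfolding provider_optimal_def is_arg_min_linorder by auto
  have xi_max: "xi P p c i \<le> xi P p c i_opt" for i
    using min[of 0 i] s by (simp add: q provider_cost_eq user_utility_abandon)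
  have le: "x i \<le> max (x M1) (x M2)" for i
    by (cases i) auto
  have "\<exists>i. max (x M1) (x M2) = x i"
    by (metis max_def)
  then obtain i where "max (x M1) (x M2) = x i" ..
  then have "utility_gap V p t qs (i_opt, s_opt) =
      max (x M1) (x M2) - user_utility V p t i_opt s_opt (qs i_opt s_opt)"
    using utility_gap_eq[of 0 _ V p t i qs] le u by auto
  then have gap: "utility_gap V p t qs (i_opt, s_opt) = max (x M1) (x M2) - x i_opt"
    using u s by simp
  \<comment> \<open>The penalty at which both initial models cost the provider the same.\<close>
  define z where "z = (c M2 - c M1) / (p M2 - p M1)"
  have "xi P p c M2 - xi P p c M1 = (P - z) * (p M2 - p M1)"
  proof -
    have "z * (p M2 - p M1) = c M2 - c M1"
      using p_less by (simp add: z_def)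
    then show ?thesis
      by (simp add: xi_def left_diff_distrib[of P z] right_diff_distrib[of P])
  qed
  then have "P < z \<Longrightarrow> xi P p c M2 < xi P p c M1" "z < P \<Longrightarrow> xi P p c M1 < xi P p c M2"
    using p_less mult_neg_pos[of "P - z" "p M2 - p M1"] mult_pos_pos[of "P - z" "p M2 - p M1"]
    by linarith+
  then have i: "P < z \<Longrightarrow> i_opt = M1" "z < P \<Longrightarrow> i_opt = M2"
    using xi_max[of M1] xi_max[of M2] by (cases i_opt; simp)+
  have "utility_gap V p t qs (i_opt, s_opt) = 0 \<longleftrightarrow> sgn (x M2 - x M1) = sgn (P - z)"
  proof (cases "P = z")
    case True
    then have "x M1 = x M2"
      using ties by (simp add: x_def z_def)
    then show ?thesis
      using True unfolding gap by (cases i_opt) simp_all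
  next
    case False
    then have "x M1 \<noteq> x M2"
      using ties by (simp add: x_def z_def)
    then show ?thesis
      using False i unfolding gap by (cases "P < z") (auto simp: sgn_real_def max_def)
  qed
  then show ?thesis
    by (simp add: x_def z_def)
qed

section \<open>The gap for mixed signs\<close>

lemma utility_gap_M1_valuable:
  assumes "0 < xi V p t M1" "xi V p t M2 \<le> 0" and s: "s \<in> {0..1}"
  shows "utility_gap V p t qs (i, s) = 0 \<longleftrightarrow> i = M1 \<and> s = 0"
proof -
  define u where "u i s = user_utility V p t i s (qs i s)" for i s
  have pos: "0 < xi V p t M1 / p M1"
    using assms p_M1_pos by simp
  \<comment> \<open>Comparison with \<open>q = 0\<close> suffices; the actual response to
    \<open>(M1, 0)\<close> need not be identified.\<close>
  have low: "xi V p t M1 / p M1 \<le> u M1 0"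
    using best_response_optimal[of 0 0 M1] by (simp add: u_def user_utility_M1)
  have less: "u i s < u M1 0" if "(i, s) \<noteq> (M1, 0)" and "s \<in> {0..1}" for i s
  proof (cases i)
    case M1
    then have "u M1 s < xi V p t M1 / p M1"
      unfolding u_def using that assms
      by (intro user_utility_M1_cascade_less best_response_range) auto
    then show ?thesis
      using M1 low by simp
  next
    case M2
    have "u M2 s \<le> 0"
      using beta_bounds(1)[OF best_response_range[of s M2]] that assms
      by (simp add: u_def user_utility_M2 mult_nonneg_nonpos)
    then show ?thesis
      using M2 low pos by simp
  qed
  have "u i s \<le> u M1 0" if "s \<in> {0..1}" for i s
    using less[OF _ that, of i] by (cases "(i, s) = (M1, 0)") (auto intro: less_imp_le)
  then have "utility_gap V p t qs (i, s) = u M1 0 - u i s"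
    using utility_gap_eq[of 0 "u M1 0" V p t M1 qs "(i, s)"] by (simp add: u_def)
  then show ?thesis
    using less[of i s] s by (cases "(i, s) = (M1, 0)") auto
qed

text \<open>The response to \<open>M2\<close> is \<open>q = 0\<close>, worth
  \<open>xi V p t M2 / p M2\<close>, which no policy starting with \<open>M1\<close>
  reaches.\<close>

lemma utility_gap_M2_valuable:
  assumes "xi V p t M1 \<le> 0" "0 < xi V p t M2" and s: "s \<in> {0..1}"
  shows "utility_gap V p t qs (i, s) = 0 \<longleftrightarrow> i = M2"
proof -
  define u where "u i s = user_utility V p t i s (qs i s)" for i s
  have u2: "u M2 s = xi V p t M2 / p M2" if "s \<in> {0..1}" for s
    using that best_response_M2[of s] assms by (simp add: u_def user_utility_M2)
  have u1: "u M1 s < xi V p t M2 / p M2" if "s \<in> {0..1}" for s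
    using that user_utility_M1_less_M2 best_response_range assms by (simp add: u_def)
  have "u i s \<le> u M2 0" if "s \<in> {0..1}" for i s
    using u1[OF that] u2[OF that] u2[of 0] by (cases i) auto
  then have "utility_gap V p t qs (i, s) = u M2 0 - u i s"
    using utility_gap_eq[of 0 "u M2 0" V p t M2 qs "(i, s)"] by (simp add: u_def)
  then show ?thesis
    using u1[OF s] u2[OF s] u2[of 0] by (cases i) auto
qed

end

end

text \<open>The equivalences between ties are needed because an indifference of only one side makes
  the signs differ while the gap can still be zero. In the third part some \<open>xi\<close> must be
  positive: if \<open>xi V p t M1 = 0\<close> and \<open>xi V p t M2 < 0\<close>, an optimal
  \<open>(M1, 0)\<close> has gap zero.\<close>

theorem proposition1:
  fixes p t c :: "model \<Rightarrow> real" and V P :: real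
    and qs :: "model \<Rightarrow> real \<Rightarrow> real" and i_opt :: model and s_opt :: real
  assumes "0 < p M1" and "p M1 < p M2" and "p M2 < 1"
    and "0 \<le> t M1" and "t M1 < t M2" and "t M2 \<le> 1"
    and "0 \<le> c M1" and "c M1 < c M2" and "c M2 \<le> 1"
    and "0 < V" and "0 < P"
    and "best_response V p t qs"
    and "provider_optimal P p c qs (i_opt, s_opt)"
  shows
    "(0 < xi V p t M1 \<and> 0 < xi V p t M2 \<and>
      (c M1 / p M1 = c M2 / p M2 \<longleftrightarrow> xi V p t M2 / p M2 = xi V p t M1 / p M1) \<longrightarrow>
        (utility_gap V p t qs (i_opt, s_opt) = 0 \<longleftrightarrow>
           sgn (c M1 / p M1 - c M2 / p M2) = sgn (xi V p t M2 / p M2 - xi V p t M1 / p M1))) \<and>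
     (xi V p t M1 < 0 \<and> xi V p t M2 < 0 \<and>
      (P = (c M2 - c M1) / (p M2 - p M1) \<longleftrightarrow> xi V p t M2 = xi V p t M1) \<longrightarrow>
        (utility_gap V p t qs (i_opt, s_opt) = 0 \<longleftrightarrow>
           sgn (xi V p t M2 - xi V p t M1) = sgn (P - (c M2 - c M1) / (p M2 - p M1)))) \<and>
     (sgn (xi V p t M1) \<noteq> sgn (xi V p t M2) \<and> (0 < xi V p t M1 \<or> 0 < xi V p t M2) \<longrightarrow>
        (utility_gap V p t qs (i_opt, s_opt) = 0 \<longleftrightarrow>
           0 < xi V p t i_opt \<and> s_opt = 0))"
proof -
  interpret two_models p
    using assms(1-3) by unfold_locales
  note best = \<open>best_response V p t qs\<close> and opt = \<open>provider_optimal P p c qs (i_opt, s_opt)\<close>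
  \<comment> \<open>\<open>s_M2\<close> is the choice of representative; it supplies
    \<open>s_opt = 0\<close> in the third part when \<open>M2\<close> is used.\<close>
  have s: "s_opt \<in> {0..1}" and s_M2: "i_opt = M2 \<Longrightarrow> s_opt = 0"
    using opt unfolding provider_optimal_def is_arg_min_def by auto
  have "utility_gap V p t qs (i_opt, s_opt) = 0 \<longleftrightarrow> 0 < xi V p t i_opt \<and> s_opt = 0"
    if "sgn (xi V p t M1) \<noteq> sgn (xi V p t M2)" and "0 < xi V p t M1 \<or> 0 < xi V p t M2"
  proof (cases "0 < xi V p t M1")
    case True
    then have "xi V p t M2 \<le> 0"
      using that by (auto simp: sgn_real_def split: if_splits)
    then show ?thesis
      using utility_gap_M1_valuable[OF best True _ s] True by (cases i_opt) auto
  next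
    case False
    then have "0 < xi V p t M2"
      using that by simp
    then show ?thesis
      using utility_gap_M2_valuable[OF best _ _ s] False s_M2 by (cases i_opt) auto
  qed
  then show ?thesis
    using utility_gap_persist[OF best _ _ _ opt] utility_gap_abandon[OF best _ _ _ opt] by blast
qed

end
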